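(* Let $m_1,m_2,m_3>0$ and let $L\in\bigwedge^2\mathbb{R}^4$ be a bivector of rank 4. Let $M_L$ be the set of states of the Newtonian 3-body problem in $\mathbb{R}^4$ with masses $m_1,m_2,m_3$ and angular momentum $L$, and let $H_{\inf}=\inf_{M_L}H$ be the infimum of the energy on $M_L$. Then there is an $\epsilon>0$ such that for every $h\in[H_{\inf},H_{\inf}+\epsilon]$ the level set $\{s\in M_L : H(s)=h\}$ is nonempty and compact.
   Context: Let $E=\mathbb{R}^4$ with its Euclidean structure. Bodies with positions $q_1,q_2,q_3\in E$ and masses $m_1,m_2,m_3>0$ have their center of mass fixed at the origin. Put $q=q_2-q_1$, $Q=q_3-(m_1q_1+m_2q_2)/(m_1+m_2)$ (Jacobi vectors), $\mu=\frac{m_1m_2}{m_1+m_2}$, $\nu=\frac{m_3(m_1+m_2)}{m_1+m_2+m_3}$, $p=\mu\dot q$, $P=\nu\dot Q$. A state is a quadruple $(q,p,Q,P)\in E^4$ for which the three bodies have pairwise distinct positions; the set of states carries the topology induced from $E^4\cong\mathbb{R}^{16}$. The mutual distances $d_{ij}=|q_i-q_j|$ are $d_{12}=|q|$, $d_{13}=|Q+\frac{m_2}{m_1+m_2}q|$, $d_{23}=|Q-\frac{m_1}{m_1+m_2}q|$. The energy is $H=T+V$ with $T=\frac{|p|^2}{2\mu}+\frac{|P|^2}{2\nu}$ and $V=-\frac{m_1m_2}{d_{12}}-\frac{m_2m_3}{d_{23}}-\frac{m_1m_3}{d_{13}}$. The angular momentum is the bivector $q\wedge p+Q\wedge P\in\bigwedge^2E$.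 Bivectors are identified with antisymmetric $4\times4$ matrices, and the rank of a bivector is the rank of this matrix. For rank 4 angular momentum $L$, $H$ is known to be bounded below on $M_L$, so $H_{\inf}$ is finite. *)

theory Defs
  imports "HOL-Analysis.Analysis"
begin

text \<open>
  Phase-space points are quadruples \<open>(q, p, Q, P)\<close> of Jacobi vectors and their conjugate momenta.
  The product type carries the topology of \<open>\<real>\<^sup>1\<^sup>6\<close>.
\<close>

type_synonym phase = "(real^4) \<times> (real^4) \<times> (real^4) \<times> (real^4)"

definition reduced_mass_inner :: "real \<Rightarrow> real \<Rightarrow> real" where
  "reduced_mass_inner m1 m2 = m1 * m2 / (m1 + m2)"

definition reduced_mass_outer :: "real \<Rightarrow> real \<Rightarrow> real \<Rightarrow> real" where
  "reduced_mass_outer m1 m2 m3 = m3 * (m1 + m2) / (m1 + m2 + m3)"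

text \<open>
  The positions of the three bodies are the solution of \<open>q = q\<^sub>2 - q\<^sub>1\<close>,
  \<open>Q = q\<^sub>3 - (m\<^sub>1 q\<^sub>1 + m\<^sub>2 q\<^sub>2) / (m\<^sub>1 + m\<^sub>2)\<close> and
  \<open>m\<^sub>1 q\<^sub>1 + m\<^sub>2 q\<^sub>2 + m\<^sub>3 q\<^sub>3 = 0\<close>; see \<open>positions_iff_jacobi\<close> below.
\<close>

definition pos1 :: "real \<Rightarrow> real \<Rightarrow> real \<Rightarrow> real^4 \<Rightarrow> real^4 \<Rightarrow> real^4" where
  "pos1 m1 m2 m3 q Q = - (m3 / (m1 + m2 + m3)) *\<^sub>R Q - (m2 / (m1 + m2)) *\<^sub>R q"

definition pos2 :: "real \<Rightarrow> real \<Rightarrow> real \<Rightarrow> real^4 \<Rightarrow> real^4 \<Rightarrow> real^4" where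
  "pos2 m1 m2 m3 q Q = - (m3 / (m1 + m2 + m3)) *\<^sub>R Q + (m1 / (m1 + m2)) *\<^sub>R q"

definition pos3 :: "real \<Rightarrow> real \<Rightarrow> real \<Rightarrow> real^4 \<Rightarrow> real^4 \<Rightarrow> real^4" where
  "pos3 m1 m2 m3 q Q = ((m1 + m2) / (m1 + m2 + m3)) *\<^sub>R Q"

definition is_state :: "real \<Rightarrow> real \<Rightarrow> real \<Rightarrow> phase \<Rightarrow> bool" where
  "is_state m1 m2 m3 = (\<lambda>(q, p, Q, P).
     pos1 m1 m2 m3 q Q \<noteq> pos2 m1 m2 m3 q Q \<and>
     pos1 m1 m2 m3 q Q \<noteq> pos3 m1 m2 m3 q Q \<and>
     pos2 m1 m2 m3 q Q \<noteq> pos3 m1 m2 m3 q Q)"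

definition kinetic :: "real \<Rightarrow> real \<Rightarrow> real \<Rightarrow> phase \<Rightarrow> real" where
  "kinetic m1 m2 m3 = (\<lambda>(q, p, Q, P).
     (norm p)\<^sup>2 / (2 * reduced_mass_inner m1 m2) +
     (norm P)\<^sup>2 / (2 * reduced_mass_outer m1 m2 m3))"

definition potential :: "real \<Rightarrow> real \<Rightarrow> real \<Rightarrow> phase \<Rightarrow> real" where
  "potential m1 m2 m3 = (\<lambda>(q, p, Q, P).
     - m1 * m2 / dist (pos1 m1 m2 m3 q Q) (pos2 m1 m2 m3 q Q)
     - m2 * m3 / dist (pos2 m1 m2 m3 q Q) (pos3 m1 m2 m3 q Q)
     - m1 * m3 / dist (pos1 m1 m2 m3 q Q) (pos3 m1 m2 m3 q Q))"

definition energy :: "real \<Rightarrow> real \<Rightarrow> real \<Rightarrow> phase \<Rightarrow> real" where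
  "energy m1 m2 m3 s = kinetic m1 m2 m3 s + potential m1 m2 m3 s"

text \<open>Bivectors are antisymmetric matrices, with \<open>u \<and> v\<close> represented by \<open>u v\<^sup>T - v u\<^sup>T\<close>.\<close>

definition is_bivector :: "real^4^4 \<Rightarrow> bool" where
  "is_bivector A \<longleftrightarrow> transpose A = - A"

definition wedge :: "real^4 \<Rightarrow> real^4 \<Rightarrow> real^4^4" where
  "wedge u v = (\<chi> i j. u $ i * v $ j - u $ j * v $ i)"

definition angular_momentum :: "phase \<Rightarrow> real^4^4" where
  "angular_momentum = (\<lambda>(q, p, Q, P). wedge q p + wedge Q P)"

definition momentum_level :: "real \<Rightarrow> real \<Rightarrow> real \<Rightarrow> real^4^4 \<Rightarrow> phase set" where
  "momentum_level m1 m2 m3 L = {s. is_state m1 m2 m3 s \<and> angular_momentum s = L}"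

text \<open>
  The infimum is taken in \<open>\<real>\<close>, so it is meaningful only if the momentum level is nonempty and the
  energy is bounded below on it; both hold for rank 4.
\<close>

definition energy_inf :: "real \<Rightarrow> real \<Rightarrow> real \<Rightarrow> real^4^4 \<Rightarrow> real" where
  "energy_inf m1 m2 m3 L = (INF s \<in> momentum_level m1 m2 m3 L. energy m1 m2 m3 s)"

lemma positions_iff_jacobi:
  fixes q1 q2 q3 q Q :: "real^4"
  assumes "m1 > 0" "m2 > 0" "m3 > 0"
  shows "q1 = pos1 m1 m2 m3 q Q \<and> q2 = pos2 m1 m2 m3 q Q \<and> q3 = pos3 m1 m2 m3 q Q \<longleftrightarrow>
    q = q2 - q1 \<and> Q = q3 - (1 / (m1 + m2)) *\<^sub>R (m1 *\<^sub>R q1 + m2 *\<^sub>R q2) \<and>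
    m1 *\<^sub>R q1 + m2 *\<^sub>R q2 + m3 *\<^sub>R q3 = 0" (is "?l \<longleftrightarrow> ?r")
proof -
  define a where "a = m1 + m2"
  define b where "b = m1 + m2 + m3"
  have m1: "m1 = a - m2" and m3: "m3 = b - a" by (auto simp: a_def b_def)
  have nz: "a \<noteq> 0" "b \<noteq> 0" using assms by (auto simp: a_def b_def)
  have comp: "x1 = - (m3 / b) * Y - (m2 / a) * x \<and> x2 = - (m3 / b) * Y + (m1 / a) * x \<and>
      x3 = (a / b) * Y \<longleftrightarrow>
      x = x2 - x1 \<and> Y = x3 - (1 / a) * (m1 * x1 + m2 * x2) \<and> m1 * x1 + m2 * x2 + m3 * x3 = 0"
    (is "?A \<longleftrightarrow> ?B") for x1 x2 x3 x Y :: real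
  proof
    assume A: ?A
    then have "x2 - x1 = (m1 / a + m2 / a) * x" by (simp add: algebra_simps)
    also have "m1 / a + m2 / a = 1" using nz unfolding m1 by (simp flip: add_divide_distrib)
    finally have x: "x = x2 - x1" by simp
    have "m1 * x1 + m2 * x2 = a * x1 + m2 * x" unfolding x m1 by (simp add: algebra_simps)
    also have "a * x1 = - (a * m3 / b) * Y - m2 * x"
      using A nz by (simp add: right_diff_distrib)
    finally have S: "m1 * x1 + m2 * x2 = - (a * m3 / b) * Y" by simp
    have x3: "x3 = (a / b) * Y" using A by blast
    have "Y = x3 - (1 / a) * (m1 * x1 + m2 * x2)"
      unfolding S x3 m3 using nz by (simp add: field_simps)
    moreover have "m1 * x1 + m2 * x2 + m3 * x3 = 0"
      unfolding S x3 by simp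
    ultimately show ?B using x by blast
  next
    assume B: ?B
    have "m1 * x1 + m2 * x2 = - m3 * x3" using B by linarith
    then have "Y = x3 - (1 / a) * (- m3 * x3)" using B by metis
    then have x3: "x3 = (a / b) * Y" using nz unfolding m3 by (simp add: field_simps)
    have x: "x = x2 - x1" using B by blast
    have "a * x1 + m2 * x = m1 * x1 + m2 * x2" unfolding x m1 by (simp add: algebra_simps)
    then have "a * x1 = - m3 * x3 - m2 * x" using B by linarith
    then have x1: "x1 = - (m3 / b) * Y - (m2 / a) * x"
      unfolding x3 using nz by (simp add: field_simps)
    have "x2 = x + x1" using B by simp
    then have "x2 = - (m3 / b) * Y + (m1 / a) * x"
      unfolding x1 m1 using nz by (simp add: field_simps)
    with x1 x3 show ?A by blast
  qed
  have "?l \<longleftrightarrow> (\<forall>i. q1 $ i = - (m3 / b) * Q $ i - (m2 / a) * q $ i \<and>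
      q2 $ i = - (m3 / b) * Q $ i + (m1 / a) * q $ i \<and> q3 $ i = (a / b) * Q $ i)"
    by (auto simp: pos1_def pos2_def pos3_def vec_eq_iff a_def b_def)
  also have "\<dots> \<longleftrightarrow> ?r"
    unfolding comp by (auto simp: vec_eq_iff a_def)
  finally show ?thesis .
qed

lemma mutual_distances:
  assumes "m1 > 0" "m2 > 0" "m3 > 0"
  shows "dist (pos1 m1 m2 m3 q Q) (pos2 m1 m2 m3 q Q) = norm q"
    and "dist (pos1 m1 m2 m3 q Q) (pos3 m1 m2 m3 q Q) = norm (Q + (m2 / (m1 + m2)) *\<^sub>R q)"
    and "dist (pos2 m1 m2 m3 q Q) (pos3 m1 m2 m3 q Q) = norm (Q - (m1 / (m1 + m2)) *\<^sub>R q)"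
proof -
  have J: "q = pos2 m1 m2 m3 q Q - pos1 m1 m2 m3 q Q"
    using positions_iff_jacobi[OF assms, of "pos1 m1 m2 m3 q Q" q Q] by blast
  then show "dist (pos1 m1 m2 m3 q Q) (pos2 m1 m2 m3 q Q) = norm q"
    by (metis dist_commute dist_norm)
  have s: "(m1 + m2) / (m1 + m2 + m3) + m3 / (m1 + m2 + m3) = 1"
    using assms by (simp flip: add_divide_distrib)
  have Q: "pos3 m1 m2 m3 q Q + (m3 / (m1 + m2 + m3)) *\<^sub>R Q = Q"
    unfolding pos3_def scaleR_add_left[symmetric] s by simp
  have "pos3 m1 m2 m3 q Q - pos1 m1 m2 m3 q Q = Q + (m2 / (m1 + m2)) *\<^sub>R q"
    using Q unfolding pos1_def by (simp add: algebra_simps)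
  then show "dist (pos1 m1 m2 m3 q Q) (pos3 m1 m2 m3 q Q) = norm (Q + (m2 / (m1 + m2)) *\<^sub>R q)"
    by (metis dist_commute dist_norm)
  have "pos3 m1 m2 m3 q Q - pos2 m1 m2 m3 q Q = Q - (m1 / (m1 + m2)) *\<^sub>R q"
    using Q unfolding pos2_def by (simp add: algebra_simps)
  then show "dist (pos2 m1 m2 m3 q Q) (pos3 m1 m2 m3 q Q) = norm (Q - (m1 / (m1 + m2)) *\<^sub>R q)"
    by (metis dist_commute dist_norm)
qed

end

theory Submission
  imports Defs
begin

text \<open>
  Let \<open>\<lambda>\<close> be the minimum of \<open>\<bar>u\<bar> \<bar>v\<bar>\<close> over all splittings \<open>L = u \<and> v + w \<and> z\<close>; it is positive since
  \<open>L\<close> is nondegenerate. In the Jacobi coordinates of any pair, \<open>\<bar>q\<bar> \<bar>p\<bar> \<ge> \<lambda>\<close>, so the centrifugal term excludes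
  collisions, and the pair alone has energy at least that \<open>E\<close> of a Kepler orbit with angular
  momentum \<open>\<lambda>\<close>. If the energy is below \<open>E\<close> for all three pairs, then no body can escape. Such
  states exist: put one pair on a Kepler orbit realising the lowest \<open>E\<close> and the third body far
  away with the remaining angular momentum. Hence low sublevel sets are compact and nonempty.
\<close>

section \<open>Splitting a bivector into two decomposable ones\<close>

lemma wedge_mult_vec: "wedge u v *v x = (v \<bullet> x) *\<^sub>R u - (u \<bullet> x) *\<^sub>R v"
  by (auto simp: wedge_def matrix_vector_mult_def vec_eq_iff inner_vec_def sum_subtractf
      sum_distrib_left sum_distrib_right algebra_simps)

lemma wedge_scale_left: "wedge (c *\<^sub>R u) v = c *\<^sub>R wedge u v"
  and wedge_scale_right: "wedge u (c *\<^sub>R v) = c *\<^sub>R wedge u v"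
  and wedge_add_left: "wedge (u + u') v = wedge u v + wedge u' v"
  and wedge_add_right: "wedge u (v + v') = wedge u v + wedge u v'"
  and wedge_diff_left: "wedge (u - u') v = wedge u v - wedge u' v"
  and wedge_diff_right: "wedge u (v - v') = wedge u v - wedge u v'"
  and wedge_minus_left: "wedge (- u) v = - wedge u v"
  and wedge_minus_right: "wedge u (- v) = - wedge u v"
  and wedge_self: "wedge u u = 0"
  by (auto simp: wedge_def vec_eq_iff algebra_simps)

lemmas wedge_linear = wedge_scale_left wedge_scale_right wedge_add_left wedge_add_right
  wedge_diff_left wedge_diff_right wedge_minus_left wedge_minus_right

lemma continuous_on_wedge [continuous_intros]:
  assumes "continuous_on S f" "continuous_on S g"
  shows "continuous_on S (\<lambda>x. wedge (f x) (g x))"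
  unfolding wedge_def using assms by (intro continuous_intros)

text \<open>Symplectic Gram-Schmidt: subtracting \<open>row 1 \<and> row k / L\<^sub>1\<^sub>k\<close> clears the rows \<open>1\<close> and \<open>k\<close>.\<close>

lemma bivector_split_exists:
  assumes "is_bivector L" "rank L = 4"
  obtains u v w z where "L = wedge u v + wedge w z"
proof -
  have anti: "L $ i $ j = - L $ j $ i" for i j
    using arg_cong[OF assms(1)[unfolded is_bivector_def], of "\<lambda>A. A $ j $ i"]
    by (simp add: transpose_def)
  have diag: "L $ i $ i = 0" for i
    using anti[of i i] by linarith
  have "row 1 L \<noteq> 0"
  proof
    assume "row 1 L = 0"
    then have "det L = 0" by (rule det_zero_row)
    then show False using assms(2) by (simp add: det_eq_0_rank)
  qed
  then obtain k where k: "L $ 1 $ k \<noteq> 0" by (auto simp: row_def vec_eq_iff)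
  then have k1: "k \<noteq> 1" using diag by auto
  define M where "M = L - wedge (row 1 L) ((1 / L $ 1 $ k) *\<^sub>R row k L)"
  have M: "M $ i $ j = L $ i $ j - (L $ 1 $ i * L $ k $ j - L $ 1 $ j * L $ k $ i) / L $ 1 $ k" for i j
    by (simp add: M_def wedge_def row_def diff_divide_distrib)
  have Manti: "M $ i $ j = - M $ j $ i" for i j
    unfolding M using anti[of i j] by (simp add: diff_divide_distrib)
  have M1: "M $ 1 $ j = 0" for j
    unfolding M using k anti[of k 1] diag[of 1] by simp
  have Mk: "M $ k $ j = 0" for j
    unfolding M using k diag[of k] by simp
  have Mdiag: "M $ i $ i = 0" for i
    using Manti[of i i] by linarith
  have zero: "M $ i $ j = 0" if "i \<in> {1, k} \<or> j \<in> {1, k}" for i j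
    using that M1 Mk Manti[of i j] by auto
  obtain a b where ab: "a \<noteq> b" "UNIV = {1, k, a, b}"
  proof -
    have "k \<in> {2, 3, 4}" using k1 exhaust_4[of k] by auto
    then consider "k = 2" | "k = 3" | "k = 4" by blast
    then show ?thesis
    proof cases
      case 1
      show ?thesis by (rule that[of 3 4]) (simp, unfold 1 UNIV_4, blast)
    next
      case 2
      show ?thesis by (rule that[of 2 4]) (simp, unfold 2 UNIV_4, blast)
    next
      case 3
      show ?thesis by (rule that[of 2 3]) (simp, unfold 3 UNIV_4, blast)
    qed
  qed
  \<comment> \<open>Antisymmetry and the vanishing rows and columns \<open>1\<close> and
    \<open>k\<close> leave only the entries \<open>ab\<close> and \<open>ba\<close>, so
    \<open>M\<close> is a multiple of a single coordinate plane.\<close>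
  have "M = wedge (M $ a $ b *\<^sub>R axis a 1) (axis b 1)"
  proof -
    have "M $ i $ j = wedge (M $ a $ b *\<^sub>R axis a 1) (axis b 1) $ i $ j" for i j
    proof (cases "i \<in> {1, k} \<or> j \<in> {1, k}")
      case True
      show ?thesis
      proof (cases "i \<in> {a, b} \<and> j \<in> {a, b}")
        case True
        then show ?thesis using ab Mdiag Manti[of b a]
          by (auto simp: wedge_def axis_def)
      next
        case False
        then show ?thesis using zero[OF \<open>i \<in> {1, k} \<or> j \<in> {1, k}\<close>]
          by (auto simp: wedge_def axis_def)
      qed
    next
      case False
      then have "i \<in> {a, b} \<and> j \<in> {a, b}" using ab(2) by blast
      then show ?thesis using ab Mdiag Manti[of b a]
        by (auto simp: wedge_def axis_def)
    qed
    then show ?thesis unfolding vec_eq_iff by blast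
  qed
  then have "L = wedge (row 1 L) ((1 / L $ 1 $ k) *\<^sub>R row k L)
      + wedge (M $ a $ b *\<^sub>R axis a 1) (axis b 1)"
    by (metis M_def diff_add_cancel add.commute)
  then show ?thesis by (rule that)
qed

lemma norm_wedge_mult_vec: "norm (wedge u v *v x) \<le> 2 * (norm u * norm v) * norm x"
proof -
  have "norm (wedge u v *v x) \<le> \<bar>v \<bullet> x\<bar> * norm u + \<bar>u \<bullet> x\<bar> * norm v"
    unfolding wedge_mult_vec by (rule order_trans[OF norm_triangle_ineq4]) simp
  also have "\<dots> \<le> (norm v * norm x) * norm u + (norm u * norm x) * norm v"
    by (intro add_mono mult_right_mono Cauchy_Schwarz_ineq2) auto
  finally show ?thesis by (simp add: algebra_simps)
qed

text \<open>Full rank bounds \<open>norm (L *v x)\<close> below by \<open>B * norm x\<close>. At a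
  nonzero \<open>x\<close> orthogonal to \<open>w\<close> and \<open>z\<close> only
  \<open>wedge u v\<close> acts, and \<open>norm_wedge_mult_vec\<close> bounds that action.\<close>

lemma positive_split_lower_bound:
  assumes "rank L = 4"
  obtains \<kappa> where "\<kappa> > 0" "\<And>u v w z. L = wedge u v + wedge w z \<Longrightarrow> \<kappa> \<le> norm u * norm v"
proof -
  have "inj ((*v) L)" using assms full_rank_injective[of L] by simp
  then obtain B where B: "B > 0" "\<And>x. B * norm x \<le> norm (L *v x)"
    using linear_inj_bounded_below_pos[OF matrix_vector_mul_linear] by blast
  have "B / 2 \<le> norm u * norm v" if L: "L = wedge u v + wedge w z" for u v w z
  proof -
    have "dim {w, z} \<le> card {w, z}" by (rule dim_le_card') simp
    also have "\<dots> \<le> 2" by (simp add: card_insert_if)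
    finally have "dim {w, z} < DIM(real^4)" by simp
    then obtain x where x: "x \<noteq> 0" "\<And>y. y \<in> span {w, z} \<Longrightarrow> orthogonal x y"
      using orthogonal_to_subspace_exists by blast
    have "w \<bullet> x = 0" "z \<bullet> x = 0"
      using x(2)[of w] x(2)[of z] by (auto simp: orthogonal_def span_base inner_commute)
    then have "L *v x = wedge u v *v x"
      unfolding L by (simp add: matrix_vector_mult_add_rdistrib wedge_mult_vec)
    then have "B * norm x \<le> 2 * (norm u * norm v) * norm x"
      using B(2)[of x] norm_wedge_mult_vec[of u v x] by simp
    then show ?thesis using x(1) by simp
  qed
  then show ?thesis using that[of "B / 2"] B(1) by auto
qed

text \<open>For rank 4, the largest such \<open>lam\<close> is the smaller of the two singular values of \<open>L\<close>.\<close>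

definition split_lower_bound :: "real^4^4 \<Rightarrow> real \<Rightarrow> bool" where
  "split_lower_bound L lam \<longleftrightarrow> lam > 0 \<and> (\<forall>u v w z. L = wedge u v + wedge w z \<longrightarrow> lam \<le> norm u * norm v)"

text \<open>
  After normalising \<open>\<bar>u\<bar> = \<bar>w\<bar> = 1\<close> and \<open>z \<bottom> w\<close>, the vector \<open>z\<close> is recovered as \<open>- (w \<and> z) w\<close>,
  so the splittings with \<open>\<bar>v\<bar>\<close> bounded form a compact set.
\<close>

lemma split_lower_bound_attained:
  assumes "is_bivector L" "rank L = 4"
  obtains lam u v w z where "split_lower_bound L lam" "L = wedge u v + wedge w z" "norm u * norm v = lam"
proof -
  obtain \<kappa> where \<kappa>: "\<kappa> > 0" "\<And>u v w z. L = wedge u v + wedge w z \<Longrightarrow> \<kappa> \<le> norm u * norm v"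
    using positive_split_lower_bound[OF assms(2)] by blast
  have nz: "u \<noteq> 0 \<and> w \<noteq> 0" if "L = wedge u v + wedge w z" for u v w z
    using \<kappa>(1) \<kappa>(2)[OF that] \<kappa>(2)[of w z u v] that by (auto simp: add.commute)
  obtain u0 v0 w0 z0 where L0: "L = wedge u0 v0 + wedge w0 z0"
    using bivector_split_exists[OF assms] by blast
  \<comment> \<open>One known splitting caps the search: a larger product cannot lower the
    minimum.\<close>
  define c where "c = norm u0 * norm v0"
  obtain B where B: "\<And>x. norm (L *v x) \<le> norm x * B"
    using bounded_linear.bounded[OF matrix_vector_mul_bounded_linear[of L]] by blast
  define K where "K = (sphere 0 1 \<times> cball 0 c \<times> sphere 0 1 \<times> cball 0 (B + 2 * c)) \<inter>
    {(u, v, w, z). wedge u v + wedge w z = L}"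
  have normalise: "\<exists>u' v' w' z'. (u', v', w', z') \<in> K \<and> norm v' = norm u * norm v"
    if L: "L = wedge u v + wedge w z" and le: "norm u * norm v \<le> c" for u v w z
  proof -
    have u: "u \<noteq> 0" and w: "w \<noteq> 0" using nz[OF L] by auto
    define u' where "u' = (1 / norm u) *\<^sub>R u"
    define v' where "v' = norm u *\<^sub>R v"
    define w' where "w' = (1 / norm w) *\<^sub>R w"
    define z1 where "z1 = norm w *\<^sub>R z"
    define z' where "z' = z1 - (w' \<bullet> z1) *\<^sub>R w'"
    have n: "norm u' = 1" "norm v' = norm u * norm v" "norm w' = 1"
      using u w by (auto simp: u'_def v'_def w'_def)
    have uv: "wedge u' v' = wedge u v" and wz: "wedge w' z' = wedge w z"
      using u w by (auto simp: u'_def v'_def w'_def z1_def z'_def wedge_linear wedge_self)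
    have ww: "w' \<bullet> w' = 1" using n(3) by (simp add: norm_eq_1)
    then have "w' \<bullet> z' = 0" by (simp add: z'_def inner_diff_right)
    then have "wedge w' z' *v w' = - z'"
      using ww by (simp add: wedge_mult_vec inner_commute)
    then have "z' = wedge u' v' *v w' - L *v w'"
      unfolding L uv wz by (simp add: matrix_vector_mult_add_rdistrib)
    then have "norm z' \<le> norm (wedge u' v' *v w') + norm (L *v w')"
      by (simp add: norm_triangle_ineq4)
    also have "\<dots> \<le> 2 * c + B"
      using norm_wedge_mult_vec[of u' v' w'] B[of w'] n le by auto
    finally have "(u', v', w', z') \<in> K"
      using n le L uv wz by (auto simp: K_def)
    then show ?thesis using n(2) by blast
  qed
  have "compact K"
    unfolding K_def case_prod_unfold
    by (intro compact_Int_closed compact_Times compact_sphere compact_cball closed_Collect_eq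
        continuous_intros)
  moreover have "K \<noteq> {}"
    using normalise[OF L0] by (auto simp: c_def)
  moreover have "continuous_on K (\<lambda>x. norm (fst (snd x)))"
    by (intro continuous_intros)
  ultimately obtain x where x: "x \<in> K" "\<And>y. y \<in> K \<Longrightarrow> norm (fst (snd x)) \<le> norm (fst (snd y))"
    using continuous_attains_inf[of K "\<lambda>x. norm (fst (snd x))"] by blast
  obtain u v w z where xx: "x = (u, v, w, z)" by (cases x)
  have Lx: "L = wedge u v + wedge w z" and nu: "norm u = 1" and vc: "norm v \<le> c"
    using x(1) by (auto simp: xx K_def)
  have "norm v \<le> norm u' * norm v'" if L: "L = wedge u' v' + wedge w' z'" for u' v' w' z'
  proof (cases "norm u' * norm v' \<le> c")
    case True
    then show ?thesis using normalise[OF L] x(2) by (fastforce simp: xx)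
  qed (use vc in simp)
  moreover have "norm v > 0" using \<kappa>(1) \<kappa>(2)[OF Lx] unfolding nu by linarith
  ultimately show ?thesis
    using that[of "norm v" u v w z] Lx nu unfolding split_lower_bound_def by auto
qed

section \<open>Changing the Jacobi pair\<close>

definition sep12 :: "phase \<Rightarrow> real" where
  "sep12 = (\<lambda>(q, p, Q, P). norm q)"

definition sep13 :: "real \<Rightarrow> real \<Rightarrow> phase \<Rightarrow> real" where
  "sep13 m1 m2 = (\<lambda>(q, p, Q, P). norm (Q + (m2 / (m1 + m2)) *\<^sub>R q))"

definition sep23 :: "real \<Rightarrow> real \<Rightarrow> phase \<Rightarrow> real" where
  "sep23 m1 m2 = (\<lambda>(q, p, Q, P). norm (Q - (m1 / (m1 + m2)) *\<^sub>R q))"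

lemma is_state_iff_sep:
  assumes "m1 > 0" "m2 > 0" "m3 > 0"
  shows "is_state m1 m2 m3 s \<longleftrightarrow> sep12 s > 0 \<and> sep13 m1 m2 s > 0 \<and> sep23 m1 m2 s > 0"
proof -
  obtain q p Q P where s: "s = (q, p, Q, P)" by (cases s)
  have "sep12 s = dist (pos1 m1 m2 m3 q Q) (pos2 m1 m2 m3 q Q)"
    "sep13 m1 m2 s = dist (pos1 m1 m2 m3 q Q) (pos3 m1 m2 m3 q Q)"
    "sep23 m1 m2 s = dist (pos2 m1 m2 m3 q Q) (pos3 m1 m2 m3 q Q)"
    unfolding mutual_distances[OF assms] by (simp_all add: s sep12_def sep13_def sep23_def)
  then show ?thesis
    by (simp add: s is_state_def)
qed

lemma energy_sep:
  assumes "m1 > 0" "m2 > 0" "m3 > 0"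
  shows "energy m1 m2 m3 s =
    kinetic m1 m2 m3 s - m1 * m2 / sep12 s - m2 * m3 / sep23 m1 m2 s - m1 * m3 / sep13 m1 m2 s"
proof -
  obtain q p Q P where s: "s = (q, p, Q, P)" by (cases s)
  show ?thesis
    unfolding s energy_def potential_def sep12_def sep13_def sep23_def prod.case
      mutual_distances[OF assms] by simp
qed

text \<open>Relabels the bodies 1 and 2; the masses are then listed as
  \<open>m2, m1, m3\<close>.\<close>

definition swap12 :: "phase \<Rightarrow> phase" where
  "swap12 = (\<lambda>(q, p, Q, P). (- q, - p, Q, P))"

text \<open>
  The passage from the Jacobi vectors of the pair \<open>12\<close> to those of the pair \<open>13\<close>, with the
  contragredient action on the momenta; the masses are then listed as \<open>m1, m3, m2\<close>.
\<close>

definition swap23 :: "real \<Rightarrow> real \<Rightarrow> real \<Rightarrow> phase \<Rightarrow> phase" where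
  "swap23 m1 m2 m3 = (\<lambda>(q, p, Q, P).
    let b = m2 / (m1 + m2); d = m3 / (m1 + m3); c = m1 * (m1 + m2 + m3) / ((m1 + m2) * (m1 + m3))
    in (Q + b *\<^sub>R q, d *\<^sub>R p + c *\<^sub>R P, c *\<^sub>R q - d *\<^sub>R Q, p - b *\<^sub>R P))"

lemma sep_swap12:
  "sep12 (swap12 s) = sep12 s"
  "sep13 m2 m1 (swap12 s) = sep23 m1 m2 s"
  "sep23 m2 m1 (swap12 s) = sep13 m1 m2 s"
  "kinetic m2 m1 m3 (swap12 s) = kinetic m1 m2 m3 s"
  "angular_momentum (swap12 s) = angular_momentum s"
  by (auto simp: swap12_def sep12_def sep13_def sep23_def kinetic_def angular_momentum_def
      reduced_mass_inner_def reduced_mass_outer_def wedge_linear algebra_simps split: prod.splits)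

text \<open>The change of Jacobi vectors is canonical: letting the inverse transpose act on the
  momenta keeps the angular momentum. The kinetic energy is a quadratic form in the momenta,
  compared coefficient by coefficient.\<close>

lemma sep_swap23:
  assumes m: "m1 > 0" "m2 > 0" "m3 > 0"
  shows "sep12 (swap23 m1 m2 m3 s) = sep13 m1 m2 s"
    and "sep13 m1 m3 (swap23 m1 m2 m3 s) = sep12 s"
    and "sep23 m1 m3 (swap23 m1 m2 m3 s) = sep23 m1 m2 s"
    and "kinetic m1 m3 m2 (swap23 m1 m2 m3 s) = kinetic m1 m2 m3 s"
    and "angular_momentum (swap23 m1 m2 m3 s) = angular_momentum s"
proof -
  obtain q p Q P where s: "s = (q, p, Q, P)" by (cases s)
  define b where "b = m2 / (m1 + m2)"
  define d where "d = m3 / (m1 + m3)"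
  define c where "c = m1 * (m1 + m2 + m3) / ((m1 + m2) * (m1 + m3))"
  have J: "swap23 m1 m2 m3 s = (Q + b *\<^sub>R q, d *\<^sub>R p + c *\<^sub>R P, c *\<^sub>R q - d *\<^sub>R Q, p - b *\<^sub>R P)"
    by (simp add: s swap23_def b_def c_def d_def Let_def)
  have nz: "m1 + m2 \<noteq> 0" "m1 + m3 \<noteq> 0" "m1 + m2 + m3 \<noteq> 0" "m1 \<noteq> 0" "m2 \<noteq> 0" "m3 \<noteq> 0"
    using m by auto
  \<comment> \<open>The map from \<open>(q, Q)\<close> to the new vectors has determinant
    \<open>- (c + b * d)\<close>; this identity makes it -1 and drives the cancellations
    below.\<close>
  have cbd: "c = 1 - b * d"
    unfolding b_def c_def d_def using nz by (simp add: divide_simps) algebra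
  have a: "m1 / (m1 + m2) = 1 - b" and a': "m1 / (m1 + m3) = 1 - d"
    using nz by (auto simp: b_def d_def field_simps)
  show "sep12 (swap23 m1 m2 m3 s) = sep13 m1 m2 s"
    unfolding J by (simp add: s sep12_def sep13_def b_def)
  have "c *\<^sub>R q - d *\<^sub>R Q + d *\<^sub>R (Q + b *\<^sub>R q) = q"
    unfolding cbd by (simp add: algebra_simps)
  then show "sep13 m1 m3 (swap23 m1 m2 m3 s) = sep12 s"
    unfolding J by (simp add: s sep12_def sep13_def d_def)
  have "c *\<^sub>R q - d *\<^sub>R Q - (1 - d) *\<^sub>R (Q + b *\<^sub>R q) = - (Q - (1 - b) *\<^sub>R q)"
    unfolding cbd by (simp add: algebra_simps)
  then have "norm (c *\<^sub>R q - d *\<^sub>R Q - (1 - d) *\<^sub>R (Q + b *\<^sub>R q)) = norm (Q - (1 - b) *\<^sub>R q)"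
    by (simp only: norm_minus_cancel)
  then show "sep23 m1 m3 (swap23 m1 m2 m3 s) = sep23 m1 m2 s"
    unfolding J unfolding s sep23_def prod.case a a' .
  \<comment> \<open>The transpose of the position map recovers the old momenta, so bilinearity of
    \<open>wedge\<close> regroups the sum into the new vectors.\<close>
  have "b *\<^sub>R (d *\<^sub>R p + c *\<^sub>R P) + c *\<^sub>R (p - b *\<^sub>R P) = p"
    "(d *\<^sub>R p + c *\<^sub>R P) - d *\<^sub>R (p - b *\<^sub>R P) = P"
    unfolding cbd by (simp_all add: algebra_simps)
  then have "wedge q p + wedge Q P =
    wedge q (b *\<^sub>R (d *\<^sub>R p + c *\<^sub>R P) + c *\<^sub>R (p - b *\<^sub>R P)) +
    wedge Q ((d *\<^sub>R p + c *\<^sub>R P) - d *\<^sub>R (p - b *\<^sub>R P))"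
    by simp
  also have "\<dots> = wedge (Q + b *\<^sub>R q) (d *\<^sub>R p + c *\<^sub>R P) + wedge (c *\<^sub>R q - d *\<^sub>R Q) (p - b *\<^sub>R P)"
    unfolding wedge_add_left wedge_add_right[of q] wedge_diff_right[of Q] wedge_diff_left
      wedge_scale_left wedge_scale_right[of q] wedge_scale_right[of Q d]
    by simp
  finally show "angular_momentum (swap23 m1 m2 m3 s) = angular_momentum s"
    unfolding J by (simp add: s angular_momentum_def)
  have sq: "(norm (x *\<^sub>R p + y *\<^sub>R P))\<^sup>2 = x\<^sup>2 * (norm p)\<^sup>2 + 2 * x * y * (p \<bullet> P) + y\<^sup>2 * (norm P)\<^sup>2" for x y
    unfolding power2_norm_eq_inner
    by (simp add: inner_add_left inner_add_right inner_commute power2_eq_square algebra_simps)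
  have sq': "(norm (p - b *\<^sub>R P))\<^sup>2 = (norm p)\<^sup>2 - 2 * b * (p \<bullet> P) + b\<^sup>2 * (norm P)\<^sup>2"
    using sq[of 1 "- b"] by simp
  define \<mu> where "\<mu> = reduced_mass_inner m1 m2"
  define \<nu> where "\<nu> = reduced_mass_outer m1 m2 m3"
  define \<mu>' where "\<mu>' = reduced_mass_inner m1 m3"
  define \<nu>' where "\<nu>' = reduced_mass_outer m1 m3 m2"
  note defs = \<mu>_def \<nu>_def \<mu>'_def \<nu>'_def reduced_mass_inner_def reduced_mass_outer_def
    b_def c_def d_def
  \<comment> \<open>Coefficients of the squared norm of \<open>p\<close>, of that of
    \<open>P\<close>, and of \<open>p \<bullet> P\<close>; the last must vanish, as the old form has
    no mixed term.\<close>
  have e1: "d\<^sup>2 / (2 * \<mu>') + 1 / (2 * \<nu>') = 1 / (2 * \<mu>)"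
    unfolding defs using nz by (simp add: divide_simps power2_eq_square) algebra
  have e2: "c\<^sup>2 / (2 * \<mu>') + b\<^sup>2 / (2 * \<nu>') = 1 / (2 * \<nu>)"
    unfolding defs using nz by (simp add: divide_simps power2_eq_square) algebra
  have e3: "d * c / \<mu>' - b / \<nu>' = 0"
    unfolding defs using nz by (simp add: divide_simps power2_eq_square)
  have "kinetic m1 m3 m2 (swap23 m1 m2 m3 s) =
    (d\<^sup>2 / (2 * \<mu>') + 1 / (2 * \<nu>')) * (norm p)\<^sup>2 + (c\<^sup>2 / (2 * \<mu>') + b\<^sup>2 / (2 * \<nu>')) * (norm P)\<^sup>2
      + (d * c / \<mu>' - b / \<nu>') * (p \<bullet> P)"
    unfolding J kinetic_def prod.case sq sq' \<mu>'_def[symmetric] \<nu>'_def[symmetric]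
    by (simp add: algebra_simps add_divide_distrib diff_divide_distrib)
  also have "\<dots> = kinetic m1 m2 m3 s"
    unfolding e1 e2 e3 by (simp add: s kinetic_def \<mu>_def \<nu>_def)
  finally show "kinetic m1 m3 m2 (swap23 m1 m2 m3 s) = kinetic m1 m2 m3 s" .
qed

text \<open>Together with \<open>swap23_level\<close> this lets a result for the pair 12 with
  arbitrary masses serve every pair.\<close>

lemma swap12_level:
  assumes "m1 > 0" "m2 > 0" "m3 > 0" "s \<in> momentum_level m1 m2 m3 L"
  shows "swap12 s \<in> momentum_level m2 m1 m3 L"
    and "energy m2 m1 m3 (swap12 s) = energy m1 m2 m3 s"
  using assms by (auto simp: momentum_level_def is_state_iff_sep energy_sep sep_swap12 mult.commute)

lemma swap23_level:
  assumes "m1 > 0" "m2 > 0" "m3 > 0" "s \<in> momentum_level m1 m2 m3 L"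
  shows "swap23 m1 m2 m3 s \<in> momentum_level m1 m3 m2 L"
    and "energy m1 m3 m2 (swap23 m1 m2 m3 s) = energy m1 m2 m3 s"
  using assms by (auto simp: momentum_level_def is_state_iff_sep energy_sep sep_swap23 mult.commute)

section \<open>The Kepler bound of a pair\<close>

text \<open>The least energy of the Kepler problem of a pair whose angular momentum is at least \<open>lam\<close>.\<close>

definition kepler_min :: "real \<Rightarrow> real \<Rightarrow> real \<Rightarrow> real" where
  "kepler_min lam m1 m2 = - ((m1 * m2)\<^sup>2 * reduced_mass_inner m1 m2 / (2 * lam\<^sup>2))"

lemma reduced_mass_pos:
  assumes "m1 > 0" "m2 > 0" "m3 > 0"
  shows "reduced_mass_inner m1 m2 > 0" "reduced_mass_outer m1 m2 m3 > 0"
  using assms by (auto simp: reduced_mass_inner_def reduced_mass_outer_def)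

text \<open>The angular momentum is itself a splitting \<open>wedge q p + wedge Q P\<close>, hence
  \<open>lam \<le> norm q * norm p\<close>. The kinetic energy of \<open>P\<close> is
  dropped.\<close>

lemma pair_bound_12:
  assumes m: "m1 > 0" "m2 > 0" "m3 > 0" and lam: "split_lower_bound L lam"
    and s: "s \<in> momentum_level m1 m2 m3 L"
  shows "lam\<^sup>2 / (2 * reduced_mass_inner m1 m2) * (1 / sep12 s)\<^sup>2 \<le> kinetic m1 m2 m3 s"
    and "kepler_min lam m1 m2 \<le> kinetic m1 m2 m3 s - m1 * m2 / sep12 s"
proof -
  obtain q p Q P where ss: "s = (q, p, Q, P)" by (cases s)
  define \<mu> where "\<mu> = reduced_mass_inner m1 m2"
  have \<mu>: "\<mu> > 0" using reduced_mass_pos[OF m] by (simp add: \<mu>_def)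
  have q: "norm q > 0"
    using s unfolding momentum_level_def by (simp add: is_state_iff_sep[OF m] ss sep12_def)
  have l: "lam > 0" "lam \<le> norm q * norm p"
    using s lam by (auto simp: split_lower_bound_def momentum_level_def ss angular_momentum_def)
  define x where "x = 1 / norm q"
  have x: "x > 0" using q by (simp add: x_def)
  have "lam * x \<le> norm p" using l(2) q by (simp add: x_def field_simps)
  then have "(lam * x)\<^sup>2 \<le> (norm p)\<^sup>2" using l(1) x by (intro power_mono) auto
  then have "(lam * x)\<^sup>2 / (2 * \<mu>) \<le> (norm p)\<^sup>2 / (2 * \<mu>)"
    using \<mu> by (intro divide_right_mono) auto
  also have "\<dots> \<le> kinetic m1 m2 m3 s"
    using reduced_mass_pos[OF m] by (simp add: ss kinetic_def \<mu>_def)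
  finally have T: "(lam * x)\<^sup>2 / (2 * \<mu>) \<le> kinetic m1 m2 m3 s" .
  then show "lam\<^sup>2 / (2 * reduced_mass_inner m1 m2) * (1 / sep12 s)\<^sup>2 \<le> kinetic m1 m2 m3 s"
    by (simp add: ss sep12_def x_def \<mu>_def power_mult_distrib power_divide mult_ac)
  \<comment> \<open>Completes the square in \<open>x\<close>; equality holds at
    \<open>x = m1 * m2 * \<mu> / lam\<^sup>2\<close>.\<close>
  have "0 \<le> (lam * x - m1 * m2 * \<mu> / lam)\<^sup>2 / (2 * \<mu>)"
    using \<mu> by simp
  also have "\<dots> = (lam * x)\<^sup>2 / (2 * \<mu>) - m1 * m2 * x + (m1 * m2)\<^sup>2 * \<mu> / (2 * lam\<^sup>2)"
    using \<mu> l(1) by (simp add: field_simps power2_eq_square)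
  finally have "kepler_min lam m1 m2 \<le> (lam * x)\<^sup>2 / (2 * \<mu>) - m1 * m2 * x"
    by (simp add: kepler_min_def \<mu>_def)
  then show "kepler_min lam m1 m2 \<le> kinetic m1 m2 m3 s - m1 * m2 / sep12 s"
    using T by (simp add: ss sep12_def x_def)
qed

lemma pair_bound_13:
  assumes m: "m1 > 0" "m2 > 0" "m3 > 0" and lam: "split_lower_bound L lam"
    and s: "s \<in> momentum_level m1 m2 m3 L"
  shows "lam\<^sup>2 / (2 * reduced_mass_inner m1 m3) * (1 / sep13 m1 m2 s)\<^sup>2 \<le> kinetic m1 m2 m3 s"
    and "kepler_min lam m1 m3 \<le> kinetic m1 m2 m3 s - m1 * m3 / sep13 m1 m2 s"
  using pair_bound_12[OF m(1,3,2) lam swap23_level(1)[OF m s]] by (auto simp: sep_swap23[OF m])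

lemma pair_bound_23:
  assumes m: "m1 > 0" "m2 > 0" "m3 > 0" and lam: "split_lower_bound L lam"
    and s: "s \<in> momentum_level m1 m2 m3 L"
  shows "lam\<^sup>2 / (2 * reduced_mass_inner m2 m3) * (1 / sep23 m1 m2 s)\<^sup>2 \<le> kinetic m1 m2 m3 s"
    and "kepler_min lam m2 m3 \<le> kinetic m1 m2 m3 s - m2 * m3 / sep23 m1 m2 s"
  using pair_bound_13[OF m(2,1,3) lam swap12_level(1)[OF m s]] by (auto simp: sep_swap12)

text \<open>
  The pair runs on the Kepler orbit of least energy and the third body sits at distance of order
  \<open>R\<close>: its attraction gains order \<open>1 / R\<close>, its kinetic energy costs only order \<open>1 / R\<^sup>2\<close>.
\<close>

lemma energy_below_kepler_min_12:
  assumes m: "m1 > 0" "m2 > 0" "m3 > 0" and lam: "split_lower_bound L lam"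
    and L: "L = wedge u v + wedge w z" and uv: "norm u * norm v = lam"
  shows "\<exists>s \<in> momentum_level m1 m2 m3 L. energy m1 m2 m3 s < kepler_min lam m1 m2"
proof -
  have l: "lam > 0" using lam by (simp add: split_lower_bound_def)
  then have u: "norm u > 0" and v: "norm v > 0" using uv by (auto simp: zero_less_mult_iff)
  \<comment> \<open>The summands may be exchanged, so the bound covers \<open>w\<close> and
    \<open>z\<close> as well.\<close>
  have "lam \<le> norm w * norm z"
    using lam L unfolding split_lower_bound_def by (metis add.commute)
  then have W: "norm w > 0" using l by (auto simp: less_le)
  define \<mu> where "\<mu> = reduced_mass_inner m1 m2"
  define \<nu> where "\<nu> = reduced_mass_outer m1 m2 m3"
  have \<mu>: "\<mu> > 0" and \<nu>: "\<nu> > 0"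
    using reduced_mass_pos[OF m] by (auto simp: \<mu>_def \<nu>_def)
  define k where "k = m1 * m2"
  have k: "k > 0" using m by (simp add: k_def)
  \<comment> \<open>Makes \<open>norm q\<close> equal to \<open>lam\<^sup>2 / (k * \<mu>)\<close>,
    the distance of equality in the Kepler bound; scaling \<open>v\<close> inversely keeps
    \<open>wedge u v\<close>.\<close>
  define \<sigma> where "\<sigma> = norm u * (norm v)\<^sup>2 / (k * \<mu>)"
  have \<sigma>: "\<sigma> > 0" using u v k \<mu> by (simp add: \<sigma>_def)
  define q where "q = \<sigma> *\<^sub>R u"
  define p where "p = (1 / \<sigma>) *\<^sub>R v"
  have nq: "norm q = \<sigma> * norm u" and np: "norm p = norm v / \<sigma>"
    using \<sigma> by (auto simp: q_def p_def)
  have kep: "(norm p)\<^sup>2 / (2 * \<mu>) - k / norm q = kepler_min lam m1 m2"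
  proof -
    have "(norm p)\<^sup>2 / (2 * \<mu>) = k\<^sup>2 * \<mu> / (2 * lam\<^sup>2)"
      unfolding np \<sigma>_def uv[symmetric] using u v k \<mu> by (simp add: field_simps power2_eq_square)
    moreover have "k / norm q = k\<^sup>2 * \<mu> / lam\<^sup>2"
      unfolding nq \<sigma>_def uv[symmetric] using u v k \<mu> by (simp add: field_simps power2_eq_square)
    ultimately show ?thesis by (simp add: kepler_min_def k_def \<mu>_def)
  qed
  \<comment> \<open>Both distances to the third body will stay below
    \<open>2 * (R * norm w)\<close>, so its two attractions add up to at least
    \<open>g / R\<close>.\<close>
  define g where "g = (m1 + m2) * m3 / (2 * norm w)"
  have g: "g > 0" using m W by (simp add: g_def)
  \<comment> \<open>The first summand places \<open>Q\<close> beyond the pair, the second makes the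
    kinetic energy of \<open>P\<close> smaller than \<open>g / R\<close>, and the 1 makes both
    strict.\<close>
  define R where "R = norm q / norm w + (norm z)\<^sup>2 / (2 * \<nu> * g) + 1"
  have R: "R > 0" "norm q < R * norm w" "(norm z)\<^sup>2 < 2 * \<nu> * g * R"
  proof -
    have pos: "0 \<le> norm q / norm w" "0 \<le> (norm z)\<^sup>2 / (2 * \<nu> * g)" using \<nu> g by auto
    then show "R > 0" unfolding R_def by linarith
    have "norm q / norm w < R" using pos unfolding R_def by linarith
    then show "norm q < R * norm w" using W by (simp add: field_simps)
    have "(norm z)\<^sup>2 / (2 * \<nu> * g) < R" using pos unfolding R_def by linarith
    then show "(norm z)\<^sup>2 < 2 * \<nu> * g * R" using \<nu> g by (simp add: field_simps)
  qed
  define Q where "Q = R *\<^sub>R w"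
  define P where "P = (1 / R) *\<^sub>R z"
  define s where "s = (q, p, Q, P)"
  have nQ: "norm Q = R * norm w" using R by (simp add: Q_def)
  have far: "0 < norm (Q + t *\<^sub>R q)" "norm (Q + t *\<^sub>R q) < 2 * (R * norm w)" if "\<bar>t\<bar> \<le> 1" for t
  proof -
    have t: "norm (t *\<^sub>R q) \<le> norm q" using that by (simp add: mult_left_le_one_le)
    show "0 < norm (Q + t *\<^sub>R q)"
      using norm_diff_ineq[of Q "t *\<^sub>R q"] t R(2) nQ by linarith
    show "norm (Q + t *\<^sub>R q) < 2 * (R * norm w)"
      using norm_triangle_ineq[of Q "t *\<^sub>R q"] t R(2) nQ by linarith
  qed
  have "\<bar>m2 / (m1 + m2)\<bar> \<le> 1" "\<bar>- (m1 / (m1 + m2))\<bar> \<le> 1" using m by auto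
  then have d13: "0 < sep13 m1 m2 s" "sep13 m1 m2 s < 2 * (R * norm w)"
    and d23: "0 < sep23 m1 m2 s" "sep23 m1 m2 s < 2 * (R * norm w)"
    using far[of "m2 / (m1 + m2)"] far[of "- (m1 / (m1 + m2))"]
    by (auto simp: s_def sep13_def sep23_def)
  have "wedge q p = wedge u v" "wedge Q P = wedge w z"
    using \<sigma> R by (auto simp: q_def p_def Q_def P_def wedge_linear)
  then have "s \<in> momentum_level m1 m2 m3 L"
    using d13 d23 \<sigma> u L unfolding momentum_level_def is_state_iff_sep[OF m]
    by (auto simp: s_def sep12_def angular_momentum_def q_def)
  moreover have "energy m1 m2 m3 s < kepler_min lam m1 m2"
  proof -
    have "m1 * m3 / (2 * (R * norm w)) \<le> m1 * m3 / sep13 m1 m2 s"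
      "m2 * m3 / (2 * (R * norm w)) \<le> m2 * m3 / sep23 m1 m2 s"
      using d13 d23 m by (auto intro!: divide_left_mono)
    moreover have "m1 * m3 / (2 * (R * norm w)) + m2 * m3 / (2 * (R * norm w)) = g / R"
      using R W by (simp add: g_def field_simps)
    moreover have "(norm P)\<^sup>2 / (2 * \<nu>) < g / R"
      using R \<nu> g by (simp add: P_def field_simps power2_eq_square)
    moreover have "energy m1 m2 m3 s = (norm p)\<^sup>2 / (2 * \<mu>) + (norm P)\<^sup>2 / (2 * \<nu>) - k / norm q
        - m2 * m3 / sep23 m1 m2 s - m1 * m3 / sep13 m1 m2 s"
      unfolding energy_sep[OF m] by (simp add: s_def kinetic_def \<mu>_def \<nu>_def sep12_def k_def)
    ultimately show ?thesis using kep by linarith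
  qed
  ultimately show ?thesis by blast
qed

text \<open>As \<open>lam\<close> does not depend on the masses, one splitting serves all pairs; the
  construction for the pair with the lowest bound is carried back by relabelling.\<close>

lemma energy_below_kepler_min:
  assumes m: "m1 > 0" "m2 > 0" "m3 > 0" and lam: "split_lower_bound L lam"
    and L: "L = wedge u v + wedge w z" and uv: "norm u * norm v = lam"
  shows "\<exists>s \<in> momentum_level m1 m2 m3 L. energy m1 m2 m3 s <
    min (kepler_min lam m1 m2) (min (kepler_min lam m1 m3) (kepler_min lam m2 m3))"
proof -
  have e12: "\<exists>s \<in> momentum_level a b c L. energy a b c s < kepler_min lam a b"
    if "a > 0" "b > 0" "c > 0" for a b c
    using energy_below_kepler_min_12[OF that lam L uv] .
  have e13: "\<exists>s \<in> momentum_level a b c L. energy a b c s < kepler_min lam a c"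
    if p: "a > 0" "b > 0" "c > 0" for a b c
  proof -
    obtain s where "s \<in> momentum_level a c b L" "energy a c b s < kepler_min lam a c"
      using e12[of a c b] p by blast
    then show ?thesis using swap23_level[of a c b s L] p by metis
  qed
  have e23: "\<exists>s \<in> momentum_level m1 m2 m3 L. energy m1 m2 m3 s < kepler_min lam m2 m3"
  proof -
    obtain s where "s \<in> momentum_level m2 m1 m3 L" "energy m2 m1 m3 s < kepler_min lam m2 m3"
      using e13[of m2 m1 m3] m by blast
    then show ?thesis using swap12_level[of m2 m1 m3 s L] m by metis
  qed
  show ?thesis
    using e12[OF m] e13[OF m] e23 unfolding min_def by presburger
qed

section \<open>Compact sublevel sets\<close>

text \<open>For \<open>x > 1\<close> the constant is absorbed into the linear term and
  \<open>x\<close> cancels; the final 1 covers \<open>x \<le> 1\<close>.\<close>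

lemma quadratic_bound:
  fixes A K h x :: real
  assumes "A > 0" "x \<ge> 0" "K \<ge> 0" "A * x\<^sup>2 \<le> K * x + h"
  shows "x \<le> (K + \<bar>h\<bar>) / A + 1"
proof (cases "x \<le> 1")
  case True
  moreover have "0 \<le> (K + \<bar>h\<bar>) / A" using assms by simp
  ultimately show ?thesis by linarith
next
  case False
  then have "\<bar>h\<bar> * 1 \<le> \<bar>h\<bar> * x" by (intro mult_left_mono) auto
  then have "(A * x) * x \<le> (K + \<bar>h\<bar>) * x"
    using assms(4) by (simp add: power2_eq_square algebra_simps)
  then have "A * x \<le> K + \<bar>h\<bar>" using False by simp
  then have "x \<le> (K + \<bar>h\<bar>) / A" using assms(1) by (simp add: field_simps)
  then show ?thesis by simp
qed

text \<open>The centrifugal bound is quadratic in the inverse distances while the potential is only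
  linear, so at any energy level the inverse distances are bounded.\<close>

lemma sublevel_no_collision:
  assumes m: "m1 > 0" "m2 > 0" "m3 > 0" and lam: "split_lower_bound L lam"
  obtains \<delta> B where "\<delta> > 0"
    "\<And>s. s \<in> momentum_level m1 m2 m3 L \<Longrightarrow> energy m1 m2 m3 s \<le> h \<Longrightarrow>
      \<delta> \<le> sep12 s \<and> \<delta> \<le> sep13 m1 m2 s \<and> \<delta> \<le> sep23 m1 m2 s \<and> kinetic m1 m2 m3 s \<le> B"
proof -
  have l: "lam > 0" using lam by (simp add: split_lower_bound_def)
  define A1 where "A1 = lam\<^sup>2 / (2 * reduced_mass_inner m1 m2)"
  define A2 where "A2 = lam\<^sup>2 / (2 * reduced_mass_inner m1 m3)"
  define A3 where "A3 = lam\<^sup>2 / (2 * reduced_mass_inner m2 m3)"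
  define A where "A = min A1 (min A2 A3)"
  have A: "A > 0" "A \<le> A1" "A \<le> A2" "A \<le> A3"
    using l m by (auto simp: A_def A1_def A2_def A3_def reduced_mass_inner_def)
  define K where "K = m1 * m2 + m2 * m3 + m1 * m3"
  have K: "K > 0" using m by (simp add: K_def add_pos_pos)
  define X where "X = (K + \<bar>h\<bar>) / A + 1"
  have X: "X > 0" using K A by (simp add: X_def add_nonneg_pos)
  show ?thesis
  proof (rule that[of "1 / X" "h + K * X"])
    show "1 / X > 0" using X by simp
  next
    fix s assume s: "s \<in> momentum_level m1 m2 m3 L" and h: "energy m1 m2 m3 s \<le> h"
    define T where "T = kinetic m1 m2 m3 s"
    define x1 where "x1 = 1 / sep12 s"
    define x2 where "x2 = 1 / sep13 m1 m2 s"
    define x3 where "x3 = 1 / sep23 m1 m2 s"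
    have pos: "sep12 s > 0" "sep13 m1 m2 s > 0" "sep23 m1 m2 s > 0"
      using s unfolding momentum_level_def is_state_iff_sep[OF m] by auto
    then have x0: "x1 > 0" "x2 > 0" "x3 > 0" by (auto simp: x1_def x2_def x3_def)
    \<comment> \<open>The inverse of the smallest distance: one variable that controls all three
      attractions and the kinetic energy.\<close>
    define x where "x = max x1 (max x2 x3)"
    have x: "x1 \<le> x" "x2 \<le> x" "x3 \<le> x" "x > 0" using x0 by (auto simp: x_def)
    have "A1 * x1\<^sup>2 \<le> T" "A2 * x2\<^sup>2 \<le> T" "A3 * x3\<^sup>2 \<le> T"
      using pair_bound_12(1)[OF m lam s] pair_bound_13(1)[OF m lam s] pair_bound_23(1)[OF m lam s]
      by (auto simp: A1_def A2_def A3_def T_def x1_def x2_def x3_def)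
    moreover have "A * x1\<^sup>2 \<le> A1 * x1\<^sup>2" "A * x2\<^sup>2 \<le> A2 * x2\<^sup>2" "A * x3\<^sup>2 \<le> A3 * x3\<^sup>2"
      using A by (auto intro: mult_right_mono)
    ultimately have T: "A * x\<^sup>2 \<le> T" by (auto simp: x_def max_def)
    have E: "T - m1 * m2 * x1 - m2 * m3 * x3 - m1 * m3 * x2 \<le> h"
      using h unfolding energy_sep[OF m] by (simp add: T_def x1_def x2_def x3_def)
    have "m1 * m2 * x1 \<le> m1 * m2 * x" "m2 * m3 * x3 \<le> m2 * m3 * x" "m1 * m3 * x2 \<le> m1 * m3 * x"
      using m x by (auto intro!: mult_left_mono)
    moreover have "K * x = m1 * m2 * x + m2 * m3 * x + m1 * m3 * x"
      by (simp add: K_def algebra_simps)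
    ultimately have TK: "T \<le> K * x + h" using E by linarith
    then have xX: "x \<le> X"
      unfolding X_def using quadratic_bound[of A x K h] A x K T by simp
    then have "K * x \<le> K * X" using K by simp
    then have "T \<le> h + K * X" using TK by linarith
    moreover have "1 / X \<le> sep12 s" "1 / X \<le> sep13 m1 m2 s" "1 / X \<le> sep23 m1 m2 s"
    proof -
      have "1 / sep12 s \<le> X" "1 / sep13 m1 m2 s \<le> X" "1 / sep23 m1 m2 s \<le> X"
        using x xX by (auto simp: x1_def x2_def x3_def)
      then show "1 / X \<le> sep12 s" "1 / X \<le> sep13 m1 m2 s" "1 / X \<le> sep23 m1 m2 s"
        using pos X by (auto simp: field_simps)
    qed
    ultimately show "1 / X \<le> sep12 s \<and> 1 / X \<le> sep13 m1 m2 s \<and> 1 / X \<le> sep23 m1 m2 s \<and>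
      kinetic m1 m2 m3 s \<le> h + K * X"
      by (simp add: T_def)
  qed
qed

text \<open>If both distances were larger, the terms would lie below the shares
  \<open>a * (\<eta> / (a + b))\<close> and \<open>b * (\<eta> / (a + b))\<close> of
  \<open>\<eta>\<close>.\<close>

lemma one_distance_bounded:
  fixes a b x y \<eta> :: real
  assumes "a > 0" "b > 0" "x > 0" "y > 0" "\<eta> > 0" "\<eta> \<le> a / x + b / y"
  shows "x \<le> (a + b) / \<eta> \<or> y \<le> (a + b) / \<eta>"
proof (rule ccontr)
  assume "\<not> ?thesis"
  then have inv: "1 / x < \<eta> / (a + b)" "1 / y < \<eta> / (a + b)"
    using assms by (auto simp: field_simps)
  have "a * (1 / x) < a * (\<eta> / (a + b))" "b * (1 / y) < b * (\<eta> / (a + b))"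
    using mult_strict_left_mono[OF inv(1) assms(1)] mult_strict_left_mono[OF inv(2) assms(2)] .
  then have "a / x + b / y < (a + b) * (\<eta> / (a + b))"
    by (simp add: distrib_right add_divide_distrib)
  then show False using assms by simp
qed

text \<open>
  Below all three Kepler bounds no pair can carry the energy alone, so each pair has a body close
  to the third one; hence at least two of the distances are bounded.
\<close>

lemma sublevel_positions_bounded:
  assumes m: "m1 > 0" "m2 > 0" "m3 > 0" and lam: "split_lower_bound L lam"
    and h: "h < kepler_min lam m1 m2" "h < kepler_min lam m1 m3" "h < kepler_min lam m2 m3"
  obtains C where "\<And>q p Q P. (q, p, Q, P) \<in> momentum_level m1 m2 m3 L \<Longrightarrow>
    energy m1 m2 m3 (q, p, Q, P) \<le> h \<Longrightarrow> norm q \<le> C \<and> norm Q \<le> C"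
proof -
  define \<eta> where "\<eta> = min (kepler_min lam m1 m2) (min (kepler_min lam m1 m3) (kepler_min lam m2 m3)) - h"
  have \<eta>: "\<eta> > 0" "\<eta> \<le> kepler_min lam m1 m2 - h" "\<eta> \<le> kepler_min lam m1 m3 - h"
    "\<eta> \<le> kepler_min lam m2 m3 - h"
    using h by (auto simp: \<eta>_def)
  define k12 where "k12 = m1 * m2"
  define k13 where "k13 = m1 * m3"
  define k23 where "k23 = m2 * m3"
  have k: "k12 > 0" "k13 > 0" "k23 > 0" using m by (auto simp: k12_def k13_def k23_def)
  define C where "C = (k12 + k13 + k23) / \<eta>"
  have C: "(k12 + k13) / \<eta> \<le> C" "(k12 + k23) / \<eta> \<le> C" "(k13 + k23) / \<eta> \<le> C"
    using k \<eta> by (auto simp: C_def divide_right_mono)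
  have C0: "C > 0" using k \<eta> by (simp add: C_def)
  show ?thesis
  proof (rule that[of "3 * C"])
    fix q p Q P assume s: "(q, p, Q, P) \<in> momentum_level m1 m2 m3 L"
      and e: "energy m1 m2 m3 (q, p, Q, P) \<le> h"
    let ?s = "(q, p, Q, P)"
    define r12 where "r12 = sep12 ?s"
    define r13 where "r13 = sep13 m1 m2 ?s"
    define r23 where "r23 = sep23 m1 m2 ?s"
    have r: "r12 > 0" "r13 > 0" "r23 > 0"
      using s unfolding momentum_level_def is_state_iff_sep[OF m] by (auto simp: r12_def r13_def r23_def)
    have E: "kinetic m1 m2 m3 ?s - k12 / r12 - k23 / r23 - k13 / r13 \<le> h"
      using e unfolding energy_sep[OF m] by (simp add: k12_def k13_def k23_def r12_def r13_def r23_def)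
    \<comment> \<open>The pair 12 alone has at least its Kepler bound, so the other two attractions
      must supply the gap \<open>\<eta>\<close>.\<close>
    have "\<eta> \<le> k13 / r13 + k23 / r23"
      using E \<eta>(2) pair_bound_12(2)[OF m lam s] unfolding r12_def[symmetric] k12_def[symmetric] by linarith
    then have c1: "r13 \<le> C \<or> r23 \<le> C"
      using one_distance_bounded[of k13 k23 r13 r23 \<eta>] k r \<eta> C by linarith
    have "\<eta> \<le> k12 / r12 + k23 / r23"
      using E \<eta>(3) pair_bound_13(2)[OF m lam s] unfolding r13_def[symmetric] k13_def[symmetric] by linarith
    then have c2: "r12 \<le> C \<or> r23 \<le> C"
      using one_distance_bounded[of k12 k23 r12 r23 \<eta>] k r \<eta> C by linarith
    have "\<eta> \<le> k12 / r12 + k13 / r13"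
      using E \<eta>(4) pair_bound_23(2)[OF m lam s] unfolding r23_def[symmetric] k23_def[symmetric] by linarith
    then have c3: "r12 \<le> C \<or> r13 \<le> C"
      using one_distance_bounded[of k12 k13 r12 r13 \<eta>] k r \<eta> C by linarith
    define a where "a = m1 / (m1 + m2)"
    define b where "b = m2 / (m1 + m2)"
    have ab: "a \<ge> 0" "b \<ge> 0" "a + b = 1"
      using m by (auto simp: a_def b_def simp flip: add_divide_distrib)
    have n: "r12 = norm q" "r13 = norm (Q + b *\<^sub>R q)" "r23 = norm (Q - a *\<^sub>R q)"
      by (simp_all add: r12_def r13_def r23_def sep12_def sep13_def sep23_def a_def b_def)
    \<comment> \<open>If \<open>r12\<close> exceeds \<open>C\<close>, both other distances are at
      most \<open>C\<close> and the triangle inequality gives \<open>2 * C\<close>. Then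
      \<open>Q\<close> is within \<open>norm q\<close> of a vector of length at most
      \<open>C\<close>, whence \<open>3 * C\<close>.\<close>
    have "(Q + b *\<^sub>R q) - (Q - a *\<^sub>R q) = (a + b) *\<^sub>R q" by (simp add: algebra_simps)
    then have "norm q \<le> norm (Q + b *\<^sub>R q) + norm (Q - a *\<^sub>R q)"
      using ab norm_triangle_ineq4[of "Q + b *\<^sub>R q" "Q - a *\<^sub>R q"] by simp
    then have q2: "norm q \<le> 2 * C" using c1 c2 c3 n C0 by linarith
    have ab1: "a \<le> 1" "b \<le> 1" using ab by auto
    have aq: "norm (a *\<^sub>R q) \<le> norm q" and bq: "norm (b *\<^sub>R q) \<le> norm q"
      using ab ab1 by (auto simp: mult_left_le_one_le)
    have "norm Q \<le> norm (Q + b *\<^sub>R q) + norm q"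
      using norm_triangle_ineq4[of "Q + b *\<^sub>R q" "b *\<^sub>R q"] bq by simp
    moreover have "norm Q \<le> norm (Q - a *\<^sub>R q) + norm q"
      using norm_triangle_ineq[of "Q - a *\<^sub>R q" "a *\<^sub>R q"] aq by simp
    ultimately show "norm q \<le> 3 * C \<and> norm Q \<le> 3 * C"
      using c1 n q2 C0 by linarith
  qed
qed

lemma continuous_on_phase_functions:
  "continuous_on S sep12" "continuous_on S (sep13 m1 m2)" "continuous_on S (sep23 m1 m2)"
  "continuous_on S (kinetic m1 m2 m3)" "continuous_on S angular_momentum"
  unfolding sep12_def sep13_def sep23_def kinetic_def angular_momentum_def case_prod_unfold divide_inverse
  by (intro continuous_intros)+

lemma continuous_on_energy:
  assumes m: "m1 > 0" "m2 > 0" "m3 > 0"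
    and "\<And>s. s \<in> S \<Longrightarrow> is_state m1 m2 m3 s"
  shows "continuous_on S (energy m1 m2 m3)"
proof -
  have "continuous_on S (\<lambda>s. kinetic m1 m2 m3 s - m1 * m2 / sep12 s - m2 * m3 / sep23 m1 m2 s
      - m1 * m3 / sep13 m1 m2 s)"
    using assms(4) unfolding is_state_iff_sep[OF m]
    by (intro continuous_on_diff continuous_on_divide continuous_on_phase_functions continuous_on_const)
      (metis less_irrefl)+
  then show ?thesis unfolding energy_sep[OF m, abs_def] .
qed

lemma compact_sublevel:
  assumes m: "m1 > 0" "m2 > 0" "m3 > 0" and lam: "split_lower_bound L lam"
    and h: "h < kepler_min lam m1 m2" "h < kepler_min lam m1 m3" "h < kepler_min lam m2 m3"
  shows "compact {s \<in> momentum_level m1 m2 m3 L. energy m1 m2 m3 s \<le> h}"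
proof -
  obtain \<delta> B where \<delta>: "\<delta> > 0"
    and B: "\<And>s. s \<in> momentum_level m1 m2 m3 L \<Longrightarrow> energy m1 m2 m3 s \<le> h \<Longrightarrow>
      \<delta> \<le> sep12 s \<and> \<delta> \<le> sep13 m1 m2 s \<and> \<delta> \<le> sep23 m1 m2 s \<and> kinetic m1 m2 m3 s \<le> B"
    using sublevel_no_collision[OF m lam, of h] by blast
  obtain C where C: "\<And>q p Q P. (q, p, Q, P) \<in> momentum_level m1 m2 m3 L \<Longrightarrow>
    energy m1 m2 m3 (q, p, Q, P) \<le> h \<Longrightarrow> norm q \<le> C \<and> norm Q \<le> C"
    using sublevel_positions_bounded[OF m lam h] by blast
  define \<mu> where "\<mu> = reduced_mass_inner m1 m2"
  define \<nu> where "\<nu> = reduced_mass_outer m1 m2 m3"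
  have \<mu>: "\<mu> > 0" and \<nu>: "\<nu> > 0"
    using reduced_mass_pos[OF m] by (auto simp: \<mu>_def \<nu>_def)
  \<comment> \<open>Demanding distances at least \<open>\<delta>\<close> replaces the open
    collision-free condition by a closed one, so \<open>D\<close> is compact and the energy is
    continuous on it.\<close>
  define D where "D = (cball 0 C \<times> cball 0 (sqrt (2 * \<mu> * B)) \<times> cball 0 C \<times> cball 0 (sqrt (2 * \<nu> * B)))
    \<inter> {s. \<delta> \<le> sep12 s} \<inter> {s. \<delta> \<le> sep13 m1 m2 s} \<inter> {s. \<delta> \<le> sep23 m1 m2 s}
    \<inter> {s. angular_momentum s = L}"
  have "compact D"
    unfolding D_def
    by (intro compact_Int_closed compact_Times compact_cball closed_Collect_eq closed_Collect_le
        continuous_on_phase_functions continuous_on_const)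
  have D_level: "s \<in> momentum_level m1 m2 m3 L" if "s \<in> D" for s
    using that \<delta> unfolding D_def momentum_level_def is_state_iff_sep[OF m] by auto
  then have "continuous_on D (energy m1 m2 m3)"
    using continuous_on_energy[OF m] by (auto simp: momentum_level_def)
  then have "closed (D \<inter> energy m1 m2 m3 -` {..h})"
    using \<open>compact D\<close> by (intro continuous_closed_preimage) (auto intro: compact_imp_closed)
  then have "compact (D \<inter> (D \<inter> energy m1 m2 m3 -` {..h}))"
    using \<open>compact D\<close> by (intro compact_Int_closed)
  moreover have "D \<inter> (D \<inter> energy m1 m2 m3 -` {..h}) =
    {s \<in> momentum_level m1 m2 m3 L. energy m1 m2 m3 s \<le> h}" (is "?l = ?r")
  proof
    show "?l \<subseteq> ?r" using D_level by auto
    show "?r \<subseteq> ?l"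
    proof
      fix s assume "s \<in> ?r"
      then have s: "s \<in> momentum_level m1 m2 m3 L" "energy m1 m2 m3 s \<le> h" by auto
      obtain q p Q P where ss: "s = (q, p, Q, P)" by (cases s)
      have T: "(norm p)\<^sup>2 / (2 * \<mu>) + (norm P)\<^sup>2 / (2 * \<nu>) \<le> B"
        using B[OF s] by (simp add: ss kinetic_def \<mu>_def \<nu>_def)
      have "0 \<le> (norm p)\<^sup>2 / (2 * \<mu>)" "0 \<le> (norm P)\<^sup>2 / (2 * \<nu>)" using \<mu> \<nu> by auto
      then have "(norm p)\<^sup>2 / (2 * \<mu>) \<le> B" "(norm P)\<^sup>2 / (2 * \<nu>) \<le> B" using T by linarith+
      then have "(norm p)\<^sup>2 \<le> 2 * \<mu> * B" "(norm P)\<^sup>2 \<le> 2 * \<nu> * B"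
        using \<mu> \<nu> by (auto simp: field_simps)
      then have "norm p \<le> sqrt (2 * \<mu> * B)" "norm P \<le> sqrt (2 * \<nu> * B)"
        by (auto intro: real_le_rsqrt)
      then show "s \<in> ?l"
        using B[OF s] C[of q p Q P] s by (auto simp: D_def ss momentum_level_def)
    qed
  qed
  ultimately show ?thesis by simp
qed

text \<open>Adding a multiple of \<open>q\<close> to \<open>p\<close> changes neither the angular momentum nor the potential.\<close>

lemma energy_attains_larger:
  assumes m: "m1 > 0" "m2 > 0" "m3 > 0"
    and s: "s \<in> momentum_level m1 m2 m3 L" and h: "energy m1 m2 m3 s \<le> h"
  shows "\<exists>s' \<in> momentum_level m1 m2 m3 L. energy m1 m2 m3 s' = h"
proof -
  obtain q p Q P where ss: "s = (q, p, Q, P)" by (cases s)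
  define \<mu> where "\<mu> = reduced_mass_inner m1 m2"
  have \<mu>: "\<mu> > 0" using reduced_mass_pos[OF m] by (simp add: \<mu>_def)
  define f where "f t = energy m1 m2 m3 (q, p + t *\<^sub>R q, Q, P)" for t
  define c where "c = energy m1 m2 m3 s - (norm p)\<^sup>2 / (2 * \<mu>)"
  have f: "f t = (norm (p + t *\<^sub>R q))\<^sup>2 / (2 * \<mu>) + c" for t
    by (simp add: f_def c_def ss energy_def kinetic_def potential_def \<mu>_def)
  have q: "norm q > 0"
    using s unfolding momentum_level_def by (simp add: is_state_iff_sep[OF m] ss sep12_def)
  \<comment> \<open>Since \<open>D \<ge> 1\<close>, its square is at least
    \<open>2 * \<mu> * \<bar>h - c\<bar>\<close>; the choice of \<open>t\<close> forces
    \<open>norm (p + t *\<^sub>R q) \<ge> D\<close>, so \<open>f\<close> passes \<open>h\<close> on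
    \<open>{0..t}\<close>.\<close>
  define D where "D = 1 + 2 * \<mu> * \<bar>h - c\<bar>"
  have D1: "D \<ge> 1" using \<mu> by (simp add: D_def)
  define t where "t = (norm p + D) / norm q"
  have t: "t \<ge> 0" using q D1 by (simp add: t_def)
  have "norm (t *\<^sub>R q) = norm p + D" using q t D1 by (simp add: t_def)
  then have "D \<le> norm (p + t *\<^sub>R q)"
    using norm_diff_ineq[of "t *\<^sub>R q" p] by (simp add: add.commute)
  then have "D\<^sup>2 \<le> (norm (p + t *\<^sub>R q))\<^sup>2" using D1 by (intro power_mono) auto
  moreover have "D * 1 \<le> D * D" using D1 by (intro mult_left_mono) auto
  ultimately have "2 * \<mu> * \<bar>h - c\<bar> \<le> (norm (p + t *\<^sub>R q))\<^sup>2"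
    unfolding power2_eq_square using D_def by linarith
  then have "\<bar>h - c\<bar> \<le> (norm (p + t *\<^sub>R q))\<^sup>2 / (2 * \<mu>)"
    using \<mu> by (simp add: field_simps)
  then have "h \<le> f t" unfolding f by linarith
  moreover have "f 0 \<le> h" using h by (simp add: f_def ss)
  moreover have "continuous_on {0..t} f"
    unfolding f divide_inverse by (intro continuous_intros)
  ultimately obtain x where "f x = h" using IVT'[of f 0 h t] t by auto
  moreover have "(q, p + x *\<^sub>R q, Q, P) \<in> momentum_level m1 m2 m3 L"
    using s by (auto simp: ss momentum_level_def is_state_def angular_momentum_def
        wedge_linear wedge_self)
  ultimately show ?thesis unfolding f_def by blast
qed

theorem theorem7:
  fixes m1 m2 m3 :: real and L :: "real^4^4"
  assumes "m1 > 0" and "m2 > 0" and "m3 > 0"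
    and "is_bivector L" and "rank L = 4"
  shows "\<exists>\<epsilon>>0. \<forall>h \<in> {energy_inf m1 m2 m3 L .. energy_inf m1 m2 m3 L + \<epsilon>}.
    {s \<in> momentum_level m1 m2 m3 L. energy m1 m2 m3 s = h} \<noteq> {} \<and>
    compact {s \<in> momentum_level m1 m2 m3 L. energy m1 m2 m3 s = h}"
proof -
  note m = assms(1-3)
  let ?M = "momentum_level m1 m2 m3 L" and ?H = "energy m1 m2 m3"
  obtain lam u v w z where lam: "split_lower_bound L lam"
    and L: "L = wedge u v + wedge w z" "norm u * norm v = lam"
    using split_lower_bound_attained[OF assms(4,5)] by blast
  define E where "E = min (kepler_min lam m1 m2) (min (kepler_min lam m1 m3) (kepler_min lam m2 m3))"
  have cpt: "compact {s \<in> ?M. ?H s \<le> h}" if "h < E" for h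
    using compact_sublevel[OF m lam] that by (simp add: E_def)
  have cont: "continuous_on {s \<in> ?M. ?H s \<le> h} ?H" for h
    by (rule continuous_on_energy[OF m]) (simp add: momentum_level_def)
  \<comment> \<open>The sublevel set of \<open>s1\<close> is compact and nonempty; a minimum on it
    is global, as all other states have larger energy.\<close>
  obtain s1 where s1: "s1 \<in> ?M" "?H s1 < E"
    using energy_below_kepler_min[OF m lam L] by (auto simp: E_def)
  have ne: "{s \<in> ?M. ?H s \<le> ?H s1} \<noteq> {}" using s1 by blast
  obtain s0 where "s0 \<in> {s \<in> ?M. ?H s \<le> ?H s1}"
    and min0: "\<forall>s \<in> {s \<in> ?M. ?H s \<le> ?H s1}. ?H s0 \<le> ?H s"
    by (rule bexE[OF continuous_attains_inf[OF cpt[OF s1(2)] ne cont]])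
  then have s0: "s0 \<in> ?M" "?H s0 \<le> ?H s1" by blast+
  have min: "?H s0 \<le> ?H s" if "s \<in> ?M" for s
  proof (cases "?H s \<le> ?H s1")
    case True
    then show ?thesis using min0 that by blast
  qed (use s0(2) in linarith)
  have inf: "energy_inf m1 m2 m3 L = ?H s0"
    unfolding energy_inf_def using s0(1) min by (intro cInf_eq_minimum) auto
  show ?thesis
  \<comment> \<open>Half of the gap keeps the closed interval strictly below \<open>E\<close>, where
    sublevel sets are compact.\<close>
  proof (intro exI[of _ "(E - ?H s0) / 2"] conjI ballI)
    show "0 < (E - ?H s0) / 2" using s0(2) s1(2) by simp
  next
    fix h assume "h \<in> {energy_inf m1 m2 m3 L .. energy_inf m1 m2 m3 L + (E - ?H s0) / 2}"
    then have h: "?H s0 \<le> h" "h \<le> ?H s0 + (E - ?H s0) / 2" by (auto simp: inf)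
    then have hE: "h < E" using s0(2) s1(2) by (simp add: field_simps)
    show "{s \<in> ?M. ?H s = h} \<noteq> {}"
      using energy_attains_larger[OF m s0(1) h(1)] by blast
    let ?K = "{s \<in> ?M. ?H s \<le> h}"
    have "closed (?K \<inter> ?H -` {h})"
      by (intro continuous_closed_preimage cont compact_imp_closed cpt hE) auto
    then have "compact (?K \<inter> (?K \<inter> ?H -` {h}))"
      using cpt[OF hE] by (intro compact_Int_closed)
    moreover have "?K \<inter> (?K \<inter> ?H -` {h}) = {s \<in> ?M. ?H s = h}" by auto
    ultimately show "compact {s \<in> ?M. ?H s = h}" by simp
  qed
qed

end
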